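(* For every $r\in\mathbb{N}$ and every $\mathbf{k}=(k_1,\dots,k_r)\in\mathbb{N}^r$, $$\mathrm{Li}_{\mathbf{k}}\Big(\frac{1+i}{2}\Big),\ \mathrm{Li}_{\mathbf{k}}\Big(\frac{1-i}{2}\Big)\in\mathrm{CMZV}^4_{|\mathbf{k}|}.$$
   Context: $i=\sqrt{-1}$. For $|x|<1$, $\mathrm{Li}_{k_1,\dots,k_r}(x)=\sum_{n_1>\cdots>n_r>0}\frac{x^{n_1}}{n_1^{k_1}\cdots n_r^{k_r}}$ (single-variable multiple polylogarithm), and $|\mathbf{k}|=k_1+\cdots+k_r$. $\mathrm{CMZV}^N_w$ is the $\mathbb{Q}$-span of all colored multiple zeta values $\sum_{n_1>\cdots>n_r>0}\prod_j z_j^{n_j}n_j^{-s_j}$ of weight $s_1+\cdots+s_r=w$ where each $z_j$ is an $N$-th root of unity and $(s_1,z_1)\ne(1,1)$. *)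

theory Defs
  imports Complex_Main
begin

text \<open>Tuples \<open>(n\<^sub>1,\<dots>,n\<^sub>r)\<close> are lists with \<open>n\<^sub>1\<close> at position 0.\<close>

definition decr_tuples :: "nat \<Rightarrow> nat \<Rightarrow> nat list set" where
  "decr_tuples r M = {n. length n = r \<and> sorted_wrt (>) n \<and> (\<forall>m\<in>set n. 0 < m \<and> m \<le> M)}"

text \<open>
  Sums over all \<open>n\<^sub>1 > \<dots> > n\<^sub>r > 0\<close> are limits of the partial sums over \<open>n\<^sub>1 \<le> M\<close>.
  For the polylogarithm with \<open>|x| < 1\<close> the series is absolutely convergent, so the order of
  summation is immaterial; a colored multiple zeta value with \<open>s\<^sub>1 = 1\<close> and \<open>z\<^sub>1 \<noteq> 1\<close> only
  converges conditionally, so there this order is needed.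
\<close>

text \<open>Meant for nonempty \<open>k\<close> only: there is no \<open>n\<^sub>1\<close> when \<open>k\<close> is empty.\<close>

definition Li :: "nat list \<Rightarrow> complex \<Rightarrow> complex" where
  "Li k x = lim (\<lambda>M. \<Sum>n\<in>decr_tuples (length k) M.
      x ^ (n ! 0) / (\<Prod>j<length k. of_nat (n ! j) ^ (k ! j)))"

definition colored_MZV :: "nat list \<Rightarrow> complex list \<Rightarrow> complex" where
  "colored_MZV s z = lim (\<lambda>M. \<Sum>n\<in>decr_tuples (length s) M.
      \<Prod>j<length s. (z ! j) ^ (n ! j) / of_nat (n ! j) ^ (s ! j))"

lemma vector_space_rat_complex: "vector_space (\<lambda>(q::rat) (x::complex). of_rat q * x)"
  by unfold_locales (simp_all add: algebra_simps of_rat_add of_rat_mult)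

definition CMZV :: "nat \<Rightarrow> nat \<Rightarrow> complex set" where
  "CMZV N w = module.span (\<lambda>(q::rat) (x::complex). of_rat q * x)
     {colored_MZV s z | s z.
        s \<noteq> [] \<and> length z = length s \<and> (\<forall>a\<in>set s. 0 < a) \<and> (\<forall>\<zeta>\<in>set z. \<zeta> ^ N = 1) \<and>
        (s ! 0, z ! 0) \<noteq> (1, 1) \<and> sum_list s = w}"

end

(* Under t = s / (s - 1) the forms dt/t and dt/(1 - t) become ds/s + ds/(1 - s) and -ds/(1 - s).
   Hence a polylogarithm at u / (u - 1), read as an iterated integral from 0, is up to sign a sum of
   polylogarithms of the same weight at u (the Landen transformation). For u = -i and u = i the point
   u / (u - 1) is (1 + i)/2 and (1 - i)/2, and a polylogarithm at a fourth root of unity u other than 1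
   is the colored multiple zeta value with colors (u, 1, ..., 1). These u lie on the circle of
   convergence; since the Taylor coefficients tend to 0 with bounded variation, the series are
   continuous on the closed disc without the point 1, so the transformation extends to them. *)

theory Submission
  imports Defs "HOL-Analysis.Analysis"
begin

section \<open>Power series with coefficients of bounded variation\<close>

text \<open>Multiplying by \<open>1 - u\<close> turns the series into an absolutely convergent one.\<close>

lemma
  fixes c :: "nat \<Rightarrow> real"
  assumes lim: "c \<longlonglongrightarrow> 0" and bv: "summable (\<lambda>n. \<bar>c (Suc n) - c n\<bar>)"
  shows summable_bounded_variation:
      "\<And>u::complex. norm u \<le> 1 \<Longrightarrow> u \<noteq> 1 \<Longrightarrow> summable (\<lambda>n. of_real (c n) * u ^ n)"
    and continuous_on_bounded_variation:
      "continuous_on (cball 0 1 - {1::complex}) (\<lambda>u. \<Sum>n. of_real (c n) * u ^ n)"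
proof -
  define b where "b n u = of_real (c (Suc n) - c n) * u ^ Suc n" for n and u :: complex
  have norm_b: "norm (b n u) \<le> \<bar>c (Suc n) - c n\<bar>" if "norm u \<le> 1" for n u
  proof -
    have "norm u ^ Suc n \<le> 1" using that by (intro power_le_one) auto
    then have "\<bar>c (Suc n) - c n\<bar> * norm u ^ Suc n \<le> \<bar>c (Suc n) - c n\<bar> * 1"
      by (intro mult_left_mono) auto
    moreover have "norm (b n u) = \<bar>c (Suc n) - c n\<bar> * norm u ^ Suc n"
      unfolding b_def norm_mult norm_power norm_of_real ..
    ultimately show ?thesis by simp
  qed
  \<comment> \<open>Summation by parts. The boundary term tends to 0 because \<open>c\<close> does
    and the powers of \<open>u\<close> stay bounded.\<close>
  have parts: "(1 - u) * (\<Sum>n<N. of_real (c n) * u ^ n)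
      = of_real (c 0) + (\<Sum>n<N. b n u) - of_real (c N) * u ^ N" for u N
  proof (induction N)
    case (Suc N)
    show ?case
      by (simp only: sum.lessThan_Suc distrib_left Suc) (simp add: b_def algebra_simps)
  qed simp
  have sums: "(\<lambda>n. of_real (c n) * u ^ n) sums ((of_real (c 0) + (\<Sum>n. b n u)) / (1 - u))"
    if u: "norm u \<le> 1" "u \<noteq> 1" for u :: complex
  proof -
    have "summable (\<lambda>n. b n u)"
      by (rule summable_comparison_test'[OF bv, of 0]) (use norm_b[OF u(1)] in auto)
    then have 1: "(\<lambda>N. \<Sum>n<N. b n u) \<longlonglongrightarrow> (\<Sum>n. b n u)"
      by (rule summable_LIMSEQ)
    have 2: "(\<lambda>N. of_real (c N) * u ^ N) \<longlonglongrightarrow> 0"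
    proof (rule Lim_null_comparison)
      show "\<forall>\<^sub>F N in sequentially. norm (of_real (c N) * u ^ N) \<le> \<bar>c N\<bar>"
      proof (rule always_eventually, rule allI)
        fix N
        have "\<bar>c N\<bar> * norm u ^ N \<le> \<bar>c N\<bar> * 1"
          using u by (intro mult_left_mono power_le_one) auto
        then show "norm (of_real (c N) * u ^ N) \<le> \<bar>c N\<bar>" by (simp add: norm_mult norm_power)
      qed
      show "(\<lambda>N. \<bar>c N\<bar>) \<longlonglongrightarrow> 0" using tendsto_rabs[OF lim] by simp
    qed
    have "(\<lambda>N. (of_real (c 0) + (\<Sum>n<N. b n u) - of_real (c N) * u ^ N) / (1 - u))
        \<longlonglongrightarrow> (of_real (c 0) + (\<Sum>n. b n u) - 0) / (1 - u)"
      using u by (intro tendsto_intros 1 2) auto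
    moreover have "(\<lambda>N. (of_real (c 0) + (\<Sum>n<N. b n u) - of_real (c N) * u ^ N) / (1 - u))
        = (\<lambda>N. \<Sum>n<N. of_real (c n) * u ^ n)"
      unfolding parts[symmetric] using u by auto
    ultimately show ?thesis by (simp add: sums_def)
  qed
  show "summable (\<lambda>n. of_real (c n) * u ^ n)" if "norm u \<le> 1" "u \<noteq> 1" for u :: complex
    using sums[OF that] by (rule sums_summable)
  \<comment> \<open>The majorants do not depend on \<open>u\<close>, so convergence is uniform up to
    the circle; only the later division by \<open>1 - u\<close> excludes the point 1.\<close>
  have "uniform_limit (cball 0 1) (\<lambda>N u. \<Sum>n<N. b n u) (\<lambda>u. \<Sum>n. b n u) sequentially"
    by (rule Weierstrass_m_test[OF _ bv]) (use norm_b in auto)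
  then have "continuous_on (cball 0 1) (\<lambda>u. \<Sum>n. b n u)"
    by (rule uniform_limit_theorem[rotated])
      (auto intro!: always_eventually continuous_intros simp: b_def)
  then have cb: "continuous_on (cball 0 1 - {1}) (\<lambda>u. \<Sum>n. b n u)"
    by (rule continuous_on_subset) auto
  have "continuous_on (cball 0 1 - {1}) (\<lambda>u. (of_real (c 0) + (\<Sum>n. b n u)) / (1 - u))"
    by (intro continuous_intros cb) auto
  then show "continuous_on (cball 0 1 - {1::complex}) (\<lambda>u. \<Sum>n. of_real (c n) * u ^ n)"
    by (rule continuous_on_eq) (use sums in \<open>auto simp: sums_iff\<close>)
qed

section \<open>Polylogarithms indexed by words\<close>

text \<open>\<open>True\<close> stands for the form \<open>dt/(1 - t)\<close> and \<open>False\<close> for \<open>dt/t\<close>; the head of a word is the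
  outermost form of the iterated integral from \<open>0\<close> to \<open>u\<close>, whose Taylor coefficients are given
  here. A word other than \<open>[]\<close> should end in \<open>True\<close>; otherwise all coefficients are \<open>0\<close>, since
  division by \<open>0\<close> gives \<open>0\<close>.\<close>

fun word_coeff :: "bool list \<Rightarrow> nat \<Rightarrow> real" where
  "word_coeff [] n = (if n = 0 then 1 else 0)"
| "word_coeff (True # w) n = (\<Sum>m<n. word_coeff w m) / real n"
| "word_coeff (False # w) n = word_coeff w n / real n"

definition word_Li :: "bool list \<Rightarrow> complex \<Rightarrow> complex" where
  "word_Li w u = (\<Sum>n. of_real (word_coeff w n) * u ^ n)"

lemma word_coeff_nonneg: "0 \<le> word_coeff w n"
  by (induction w n rule: word_coeff.induct) (auto intro!: divide_nonneg_nonneg sum_nonneg)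

lemma word_coeff_0: "w \<noteq> [] \<Longrightarrow> word_coeff w 0 = 0"
  by (cases "(w, 0::nat)" rule: word_coeff.cases) auto

lemma word_Li_0: "w \<noteq> [] \<Longrightarrow> word_Li w 0 = 0"
  by (simp add: word_Li_def word_coeff_0)

lemma word_Li_Nil: "word_Li [] u = 1"
proof -
  have "word_Li [] u = (\<Sum>n\<in>{0}. of_real (word_coeff [] n) * u ^ n)"
    unfolding word_Li_def by (rule suminf_finite) auto
  then show ?thesis by simp
qed

section \<open>Size and variation of the Taylor coefficients\<close>

lemma sum_inverse_sqrt_le: "(\<Sum>m\<le>n. 1 / sqrt (real m)) \<le> 2 * sqrt (real n)"
proof (induction n)
  case (Suc n)
  define a b where "a = sqrt (real n)" and "b = sqrt (real (Suc n))"
  have ab: "0 \<le> a" "a \<le> b" "0 < b" by (auto simp: a_def b_def)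
  \<comment> \<open>Telescoping: as \<open>a\<close> is at most \<open>b\<close>, this identity
    bounds the new term \<open>1 / b\<close> by \<open>2 * (b - a)\<close>.\<close>
  have "(b - a) * (b + a) = 1" by (simp add: a_def b_def algebra_simps)
  moreover have "(b - a) * (b + a) \<le> (b - a) * (2 * b)"
    using ab by (intro mult_left_mono) auto
  ultimately have "1 / b \<le> 2 * b - 2 * a"
    using ab by (simp add: field_simps)
  then show ?case using Suc by (simp add: a_def b_def)
qed simp

text \<open>The pointwise bound is a hypothesis here so that the estimate can serve both inside the
  induction for \<open>word_coeff_le\<close> and afterwards for the differences.\<close>

lemma sum_word_coeff_le:
  assumes "\<And>n. 0 < n \<Longrightarrow> word_coeff w n \<le> 2 ^ length w / sqrt (real n)"
  shows "(\<Sum>m<n. word_coeff w m) \<le> 2 ^ Suc (length w) * sqrt (real n)"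
\<comment> \<open>The majorant at \<open>m = 0\<close> is \<open>1 / sqrt 0 = 0\<close>. It does not
  dominate the coefficient 1 of the empty word, but suffices for a nonempty word, whose coefficient
  at 0 vanishes.\<close>
proof (cases "w = [] \<or> n = 0")
  case True
  have "(\<Sum>m<n. word_coeff [] m) \<le> 2 * sqrt (real n)"
  proof (cases n)
    case (Suc m)
    have "(\<Sum>m<n. word_coeff [] m) = 1" using Suc by (simp add: sum.delta)
    moreover have "1 \<le> sqrt (real n)" using Suc by simp
    ultimately show ?thesis by linarith
  qed simp
  then show ?thesis using True by auto
next
  case False
  then obtain k where n: "n = Suc k" by (cases n) auto
  have "(\<Sum>m<n. word_coeff w m) \<le> (\<Sum>m<n. 2 ^ length w * (1 / sqrt (real m)))"
  proof (rule sum_mono)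
    fix m
    show "word_coeff w m \<le> 2 ^ length w * (1 / sqrt (real m))"
      using assms[of m] False by (cases "m = 0") (auto simp: word_coeff_0)
  qed
  also have "\<dots> = 2 ^ length w * (\<Sum>m\<le>k. 1 / sqrt (real m))"
    by (simp add: n sum_distrib_left lessThan_Suc_atMost del: sum.lessThan_Suc)
  also have "\<dots> \<le> 2 ^ length w * (2 * sqrt (real k))"
    by (intro mult_left_mono sum_inverse_sqrt_le) auto
  also have "\<dots> \<le> 2 ^ length w * (2 * sqrt (real n))"
    by (intro mult_left_mono) (auto simp: n)
  finally show ?thesis by simp
qed

text \<open>The letter \<open>True\<close> averages the preceding coefficients, and averaging
  reproduces the decay \<open>1 / sqrt n\<close> at the cost of a factor 2. This crude rate avoids
  tracking powers of logarithms.\<close>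

lemma word_coeff_le: "0 < n \<Longrightarrow> word_coeff w n \<le> 2 ^ length w / sqrt (real n)"
proof (induction w arbitrary: n)
  case (Cons a w)
  show ?case
  proof (cases a)
    case True
    have "(\<Sum>m<n. word_coeff w m) \<le> 2 ^ Suc (length w) * sqrt (real n)"
      by (rule sum_word_coeff_le) (rule Cons.IH)
    then have "(\<Sum>m<n. word_coeff w m) / real n \<le> 2 ^ Suc (length w) * sqrt (real n) / real n"
      by (rule divide_right_mono) simp
    also have "\<dots> = 2 ^ Suc (length w) / sqrt (real n)"
      using Cons.prems by (simp add: field_simps)
    finally show ?thesis using True by simp
  next
    case False
    have "word_coeff w n / real n \<le> word_coeff w n / 1"
      using Cons.prems by (intro divide_left_mono word_coeff_nonneg) auto
    also have "\<dots> \<le> 2 ^ length w / sqrt (real n)" using Cons by simp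
    also have "\<dots> \<le> 2 ^ Suc (length w) / sqrt (real n)"
      by (intro divide_right_mono) auto
    finally show ?thesis using False by simp
  qed
qed simp

lemma word_coeff_tendsto_0: "word_coeff w \<longlonglongrightarrow> 0"
proof (rule Lim_null_comparison)
  show "\<forall>\<^sub>F n in sequentially. norm (word_coeff w n) \<le> 2 ^ length w / sqrt (real n)"
    using eventually_gt_at_top[of 0]
    by eventually_elim (use word_coeff_le word_coeff_nonneg in auto)
  show "(\<lambda>n. 2 ^ length w / sqrt (real n)) \<longlonglongrightarrow> 0"
    by (intro real_tendsto_divide_at_top[OF tendsto_const]
        filterlim_compose[OF sqrt_at_top filterlim_real_sequentially])
qed

lemma word_coeff_diff_le:
  assumes "w \<noteq> []" "0 < n"
  shows "\<bar>word_coeff w (Suc n) - word_coeff w n\<bar> \<le> 3 * 2 ^ length w / (real n * sqrt (real n))"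
proof (cases "(w, n)" rule: word_coeff.cases)
  case (2 v k)
  define S where "S = (\<Sum>m<n. word_coeff v m)"
  have S: "0 \<le> S" "S \<le> 2 ^ Suc (length v) * sqrt (real n)"
    unfolding S_def by (intro sum_nonneg word_coeff_nonneg, intro sum_word_coeff_le word_coeff_le)
  have c: "0 \<le> word_coeff v n" "word_coeff v n \<le> 2 ^ length v / sqrt (real n)"
    using assms by (auto intro: word_coeff_nonneg word_coeff_le)
  have "(S + c) / (x + 1) - S / x = c / (x + 1) - S / (x * (x + 1))" if "0 < x" for c x :: real
    using that by (simp add: divide_simps) (simp add: algebra_simps)
  from this[of "real n" "word_coeff v n"] have "word_coeff w (Suc n) - word_coeff w n
      = word_coeff v n / real (Suc n) - S / (real n * real (Suc n))"
    using assms 2 by (simp add: S_def add.commute)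
  then have "\<bar>word_coeff w (Suc n) - word_coeff w n\<bar>
      \<le> word_coeff v n / real (Suc n) + S / (real n * real (Suc n))"
    using S(1) c(1) by (simp add: abs_le_iff add_nonneg_nonneg)
  also have "\<dots> \<le> (2 ^ length v / sqrt (real n)) / real n
      + (2 ^ Suc (length v) * sqrt (real n)) / (real n * real n)"
    using S c assms by (intro add_mono frac_le mult_mono) auto
  also have "\<dots> = 3 * 2 ^ length v / (real n * sqrt (real n))"
    using assms by (simp add: field_simps)
  also have "\<dots> \<le> 3 * 2 ^ length w / (real n * sqrt (real n))"
    using 2 by (intro divide_right_mono) auto
  finally show ?thesis .
next
  case (3 v k)
  define C :: real where "C = 2 ^ length v / sqrt (real n)"
  have C: "word_coeff v n \<le> C" using assms by (simp add: C_def word_coeff_le)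
  have "word_coeff v (Suc n) \<le> 2 ^ length v / sqrt (real (Suc n))" by (intro word_coeff_le) auto
  also have "\<dots> \<le> C" unfolding C_def using assms by (intro divide_left_mono) auto
  finally have C': "word_coeff v (Suc n) \<le> C" .
  have "word_coeff w n \<le> C / real n" using 3 C by (simp add: divide_right_mono)
  moreover have "word_coeff w (Suc n) \<le> C / real n"
    using 3 C' assms by (auto intro!: frac_le word_coeff_nonneg order_trans[OF word_coeff_nonneg C])
  ultimately have "\<bar>word_coeff w (Suc n) - word_coeff w n\<bar> \<le> C / real n"
    using word_coeff_nonneg[of w n] word_coeff_nonneg[of w "Suc n"] by linarith
  also have "\<dots> = 2 ^ length v / (real n * sqrt (real n))" by (simp add: C_def)
  also have "\<dots> \<le> 3 * 2 ^ length w / (real n * sqrt (real n))"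
    using 3 by (intro divide_right_mono) auto
  finally show ?thesis .
qed (use assms in auto)

lemma summable_word_coeff_diff: "summable (\<lambda>n. \<bar>word_coeff w (Suc n) - word_coeff w n\<bar>)"
proof (cases "w = []")
  case True
  show ?thesis by (rule summable_finite[of "{0}"]) (auto simp: True)
next
  case False
  have "summable (\<lambda>n. 3 * 2 ^ length w * (real n powr (-3/2)))"
    by (intro summable_mult) (simp add: summable_real_powr_iff)
  then show ?thesis
  \<comment> \<open>The index 0 is skipped: \<open>0 powr (-3/2)\<close> is 0, while the difference
    there is 1 for the word \<open>[True]\<close>.\<close>
  proof (rule summable_comparison_test'[where N = 1])
    fix n :: nat assume n: "1 \<le> n"
    have "real n powr (1 + 1/2) = real n powr 1 * real n powr (1/2)"
      by (rule powr_add)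
    then have "real n powr (3/2) = real n * sqrt (real n)" using n by (simp add: powr_half_sqrt)
    then have "real n powr (-3/2) = 1 / (real n * sqrt (real n))"
      by (simp add: powr_minus_divide)
    then show "norm \<bar>word_coeff w (Suc n) - word_coeff w n\<bar> \<le> 3 * 2 ^ length w * real n powr (-3/2)"
      using word_coeff_diff_le[OF False, of n] n by simp
  qed
qed

lemmas summable_word_Li = summable_bounded_variation[OF word_coeff_tendsto_0 summable_word_coeff_diff]

lemma word_Li_sums:
  "norm u \<le> 1 \<Longrightarrow> u \<noteq> 1 \<Longrightarrow> (\<lambda>n. of_real (word_coeff w n) * u ^ n) sums word_Li w u"
  unfolding word_Li_def by (intro summable_sums summable_word_Li)

lemma continuous_on_word_Li: "continuous_on (cball 0 1 - {1}) (word_Li w)"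
  using continuous_on_bounded_variation[OF word_coeff_tendsto_0 summable_word_coeff_diff]
  unfolding word_Li_def[abs_def] .

section \<open>Differential equations in the open disc\<close>

lemma word_Li_has_derivative_diffs:
  assumes "norm u < 1"
  shows "(word_Li w has_field_derivative (\<Sum>n. diffs (\<lambda>n. of_real (word_coeff w n)) n * u ^ n)) (at u)"
  unfolding word_Li_def[abs_def]
  by (rule termdiffs_strong'[of 1]) (use assms in \<open>auto intro!: summable_word_Li\<close>)

text \<open>The Cauchy product with the geometric series \<open>1 / (1 - u)\<close> turns
  coefficients into partial sums, and \<open>word_coeff (True # w)\<close> divides exactly these by
  the index.\<close>

lemma word_Li_True_has_derivative:
  assumes u: "norm u < 1"
  shows "(word_Li (True # w) has_field_derivative word_Li w u / (1 - u)) (at u)"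
proof -
  have "summable (\<lambda>n. norm (of_real (word_coeff w n) * u ^ n))"
    \<comment> \<open>Convergence at -1, a point of the circle other than 1, gives absolute
      convergence inside.\<close>
    by (rule powser_insidea[of _ "-1"]) (use u in \<open>auto intro!: summable_word_Li\<close>)
  moreover have "summable (\<lambda>n. norm (u ^ n))"
    using u by (simp add: norm_power summable_geometric)
  ultimately have "word_Li w u * (\<Sum>n. u ^ n)
      = (\<Sum>n. \<Sum>i\<le>n. (of_real (word_coeff w i) * u ^ i) * u ^ (n - i))"
    unfolding word_Li_def by (rule Cauchy_product)
  also have "\<dots> = (\<Sum>n. diffs (\<lambda>n. of_real (word_coeff (True # w) n)) n * u ^ n)"
  proof (rule suminf_cong)
    fix n
    have "(\<Sum>i\<le>n. (of_real (word_coeff w i) * u ^ i) * u ^ (n - i))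
        = (\<Sum>i\<le>n. of_real (word_coeff w i) * u ^ n)"
      by (rule sum.cong) (auto simp: mult.assoc simp flip: power_add)
    also have "\<dots> = of_real (\<Sum>i<Suc n. word_coeff w i) * u ^ n"
      by (simp add: sum_distrib_right lessThan_Suc_atMost del: sum.lessThan_Suc)
    also have "\<dots> = diffs (\<lambda>n. of_real (word_coeff (True # w) n)) n * u ^ n"
      by (simp add: diffs_def del: of_nat_Suc sum.lessThan_Suc)
    finally show "(\<Sum>i\<le>n. (of_real (word_coeff w i) * u ^ i) * u ^ (n - i))
        = diffs (\<lambda>n. of_real (word_coeff (True # w) n)) n * u ^ n" .
  qed
  finally show ?thesis
    using word_Li_has_derivative_diffs[OF u, of "True # w"] u by (simp add: suminf_geometric)
qed

text \<open>Differentiation cancels the division by \<open>n\<close> and leaves the series of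
  \<open>w\<close> shifted by one index. A nonempty \<open>w\<close> has no constant term, so the
  shift is division by \<open>u\<close>.\<close>

lemma word_Li_False_has_derivative:
  assumes u: "norm u < 1" "u \<noteq> 0" and w: "w \<noteq> []"
  shows "(word_Li (False # w) has_field_derivative word_Li w u / u) (at u)"
proof -
  have "summable (\<lambda>n. of_real (word_coeff w n) * u ^ n)"
    using u by (intro summable_word_Li) auto
  from powser_split_head(1)[OF this] have "word_Li w u
      = (\<Sum>n. of_real (word_coeff w (Suc n)) * u ^ n) * u"
    using w by (simp add: word_Li_def word_coeff_0)
  moreover have "diffs (\<lambda>n. of_real (word_coeff (False # w) n)) = (\<lambda>n. of_real (word_coeff w (Suc n)) :: complex)"
    by (auto simp: diffs_def simp del: of_nat_Suc)
  ultimately show ?thesis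
    using word_Li_has_derivative_diffs[OF u(1), of "False # w"] u by simp
qed

section \<open>The Landen transformation\<close>

text \<open>These are the words obtained by expanding the pulled-back forms, with multiplicity and
  without signs. Each letter \<open>True\<close> of the original word contributes one factor -1,
  which \<open>word_Li_landen\<close> restores.\<close>

primrec landen :: "bool list \<Rightarrow> bool list list" where
  "landen [] = [[]]"
| "landen (a # w) = map ((#) True) (landen w) @ (if a then [] else map ((#) False) (landen w))"

lemma length_landen: "v \<in> set (landen w) \<Longrightarrow> length v = length w"
  by (induction w arbitrary: v) (auto split: if_splits)

text \<open>A letter \<open>True\<close> is only ever replaced by \<open>True\<close>. Thus the
  words of the expansion still come from index lists.\<close>

lemma landen_last: "v \<in> set (landen w) \<Longrightarrow> w \<noteq> [] \<Longrightarrow> last w \<Longrightarrow> last v"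
proof (induction w arbitrary: v)
  case (Cons a w)
  show ?case
  proof (cases "w = []")
    case False
    from Cons.prems(1) obtain b v' where v: "v = b # v'" "v' \<in> set (landen w)"
      by (auto split: if_splits)
    moreover have "v' \<noteq> []" using length_landen[OF v(2)] False by auto
    ultimately show ?thesis using Cons False by auto
  qed (use Cons in \<open>auto split: if_splits\<close>)
qed simp

definition landen_sum :: "bool list \<Rightarrow> complex \<Rightarrow> complex" where
  "landen_sum w u = (\<Sum>v\<leftarrow>landen w. word_Li v u)"

lemma has_field_derivative_sum_list:
  assumes "\<And>x. x \<in> set xs \<Longrightarrow> (f x has_field_derivative f' x) (at u)"
  shows "((\<lambda>u. \<Sum>x\<leftarrow>xs. f x u) has_field_derivative (\<Sum>x\<leftarrow>xs. f' x)) (at u)"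
  using assms by (induction xs) (auto intro!: DERIV_add)

lemma sum_list_divide: "(\<Sum>x\<leftarrow>xs. f x / (c :: complex)) = (\<Sum>x\<leftarrow>xs. f x) / c"
  by (induction xs) (auto simp: add_divide_distrib)

lemma landen_sum_Cons_has_derivative:
  assumes u: "norm u < 1" "a \<or> u \<noteq> 0 \<and> w \<noteq> []"
  shows "(landen_sum (a # w) has_field_derivative
    landen_sum w u * (1 / (1 - u) + (if a then 0 else 1 / u))) (at u)"
proof -
  have T: "((\<lambda>u. \<Sum>v\<leftarrow>landen w. word_Li (True # v) u) has_field_derivative landen_sum w u / (1 - u)) (at u)"
    unfolding landen_sum_def sum_list_divide[symmetric]
    using u by (intro has_field_derivative_sum_list word_Li_True_has_derivative)
  show ?thesis
  proof (cases a)
    case True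
    then show ?thesis using T by (simp add: landen_sum_def[abs_def] o_def)
  next
    case False
    have F: "((\<lambda>u. \<Sum>v\<leftarrow>landen w. word_Li (False # v) u) has_field_derivative landen_sum w u / u) (at u)"
      unfolding landen_sum_def sum_list_divide[symmetric]
      using u False length_landen
      by (intro has_field_derivative_sum_list word_Li_False_has_derivative) fastforce+
    show ?thesis using DERIV_add[OF T F] False
      by (simp add: landen_sum_def[abs_def] o_def algebra_simps)
  qed
qed

lemma continuous_on_landen_sum: "continuous_on (cball 0 1 - {1}) (landen_sum w)"
proof -
  have "continuous_on (cball 0 1 - {1}) (\<lambda>u. \<Sum>v\<leftarrow>xs. word_Li v u)" for xs
    by (induction xs) (auto intro!: continuous_intros continuous_on_word_Li)
  then show ?thesis unfolding landen_sum_def[abs_def] .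
qed

lemma landen_sum_0: "w \<noteq> [] \<Longrightarrow> landen_sum w 0 = 0"
proof -
  assume "w \<noteq> []"
  then have "word_Li v 0 = 0" if "v \<in> set (landen w)" for v
    using length_landen[OF that] by (intro word_Li_0) auto
  then have "landen_sum w 0 = (\<Sum>v\<leftarrow>landen w. 0)"
    unfolding landen_sum_def by (intro arg_cong[where f = sum_list] map_cong refl)
  then show ?thesis by simp
qed

text \<open>The line \<open>Re u = 1/2\<close> is the perpendicular bisector of 0 and 1; to its
  left, \<open>u\<close> is closer to 0 than to 1.\<close>

lemma norm_landen_less_1:
  assumes "Re u < 1/2" shows "norm (u / (u - 1)) < 1"
proof -
  have "(norm u)\<^sup>2 < (norm (u - 1))\<^sup>2"
    unfolding cmod_power2 using assms by (simp add: power2_eq_square algebra_simps)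
  then have "norm u < norm (u - 1)" by (rule power2_less_imp_less) simp
  moreover have "0 < norm (u - 1)" using \<open>norm u < norm (u - 1)\<close> norm_ge_zero[of u] by linarith
  ultimately show ?thesis by (simp add: norm_divide)
qed

text \<open>By induction on the word, both sides have the same derivative inside the disc away from
  0. They agree at 0, and continuity along the segment from 0 to \<open>u\<close> carries the
  equality to the circle.\<close>

lemma word_Li_landen:
  assumes "w \<noteq> [] \<longrightarrow> last w" "norm u \<le> 1" "Re u < 1/2"
  shows "word_Li w (u / (u - 1)) = (-1) ^ count_list w True * landen_sum w u"
  using assms
proof (induction w arbitrary: u)
  case Nil
  show ?case by (simp add: landen_sum_def word_Li_Nil)
next
  case (Cons a w)
  define s :: complex where "s = (-1) ^ count_list w True"
  define s' :: complex where "s' = (-1) ^ count_list (a # w) True"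
  define G where "G x = word_Li (a # w) (x / (x - 1)) - s' * landen_sum (a # w) x" for x
  have w: "a \<or> w \<noteq> []" "w \<noteq> [] \<longrightarrow> last w" using Cons.prems(1) by (auto split: if_splits)
  have s': "s' = (if a then - s else s)" by (simp add: s_def s'_def)
  have deriv: "(G has_field_derivative 0) (at x)" if x: "norm x < 1" "Re x < 1/2" "x \<noteq> 0" for x
  proof -
    define z where "z = x / (x - 1)"
    have x1: "x - 1 \<noteq> 0" using x by auto
    have z: "norm z < 1" "z \<noteq> 0" using norm_landen_less_1[OF x(2)] x x1 by (auto simp: z_def)
    have IH: "word_Li w z = s * landen_sum w x"
      unfolding z_def s_def using Cons.IH[of x] x w by simp
    have "1 - z = - 1 / (x - 1)" using x1 by (simp add: z_def field_simps)
    then have z1: "1 / (1 - z) = - (x - 1)" by simp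
    have dz: "((\<lambda>x. x / (x - 1)) has_field_derivative - 1 / (x - 1)\<^sup>2) (at x)"
      by (rule DERIV_cong[OF DERIV_divide[OF DERIV_ident DERIV_diff[OF DERIV_ident DERIV_const] x1]])
        (simp add: power2_eq_square)
    have "(word_Li (a # w) has_field_derivative word_Li w z * (if a then 1 / (1 - z) else 1 / z)) (at z)"
      using word_Li_True_has_derivative[OF z(1), of w] word_Li_False_has_derivative[OF z, of w] w
      by (cases a) auto
    then have "(word_Li (a # w) has_field_derivative word_Li w z * (if a then 1 / (1 - z) else 1 / z))
        (at (x / (x - 1)))" by (simp add: z_def)
    from DERIV_chain2[OF this dz]
    have 1: "((\<lambda>x. word_Li (a # w) (x / (x - 1))) has_field_derivative
        word_Li w z * (if a then 1 / (1 - z) else 1 / z) * (- 1 / (x - 1)\<^sup>2)) (at x)" .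
    have 2: "(landen_sum (a # w) has_field_derivative
        landen_sum w x * (1 / (1 - x) + (if a then 0 else 1 / x))) (at x)"
      using x w by (intro landen_sum_Cons_has_derivative) auto
    \<comment> \<open>The pullback of the two forms along \<open>x / (x - 1)\<close>; the sign -1
      for \<open>True\<close> is the one that separates \<open>s'\<close> from
      \<open>s\<close>.\<close>
    have "(if a then 1 / (1 - z) else 1 / z) * (- 1 / (x - 1)\<^sup>2)
        = (if a then - 1 else 1) * (1 / (1 - x) + (if a then 0 else 1 / x))"
    proof (cases a)
      case True
      have "- y * (- 1 / y\<^sup>2) = - (1 / - y)" if "y \<noteq> 0" for y :: complex
        using that by (simp add: power2_eq_square)
      from this[OF x1] have "- (x - 1) * (- 1 / (x - 1)\<^sup>2) = - (1 / (1 - x))" by simp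
      then show ?thesis using True z1 by simp
    next
      case False
      have "1 - x \<noteq> 0" using x1 by auto
      then have "1 / z * (- 1 / (x - 1)\<^sup>2) = 1 / (1 - x) + 1 / x"
        unfolding z_def using x x1 by (simp add: divide_simps power2_eq_square)
      then show ?thesis using False by simp
    qed
    then have "word_Li w z * (if a then 1 / (1 - z) else 1 / z) * (- 1 / (x - 1)\<^sup>2)
        = s' * (landen_sum w x * (1 / (1 - x) + (if a then 0 else 1 / x)))"
      unfolding IH s' mult.assoc by (auto simp: algebra_simps)
    with 1 2 show ?thesis
      unfolding G_def by (auto intro!: derivative_eq_intros)
  qed
  have cont: "continuous_on {x. norm x \<le> 1 \<and> Re x < 1/2} G"
    unfolding G_def
  proof (intro continuous_intros)
    show "continuous_on {x. norm x \<le> 1 \<and> Re x < 1/2} (\<lambda>x. word_Li (a # w) (x / (x - 1)))"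
    proof (rule continuous_on_compose2[OF continuous_on_word_Li[of "a # w"]])
      show "continuous_on {x. norm x \<le> 1 \<and> Re x < 1/2} (\<lambda>x. x / (x - 1))"
        by (intro continuous_intros) auto
      show "(\<lambda>x. x / (x - 1)) ` {x. norm x \<le> 1 \<and> Re x < 1/2} \<subseteq> cball 0 1 - {1}"
        using norm_landen_less_1 by (force simp: less_imp_le)
    qed
    show "continuous_on {x. norm x \<le> 1 \<and> Re x < 1/2} (landen_sum (a # w))"
      by (rule continuous_on_subset[OF continuous_on_landen_sum]) auto
  qed
  define f where "f t = G (of_real t * u)" for t :: real
  \<comment> \<open>The bound by \<open>t\<close>, not just by 1, puts all points with
    \<open>t < 1\<close> inside the open disc even if \<open>u\<close> lies on the circle.\<close>
  have seg: "norm (of_real t * u) \<le> t" "Re (of_real t * u) < 1/2" if "0 \<le> t" "t \<le> 1" for t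
  proof -
    show "norm (of_real t * u) \<le> t"
      using that Cons.prems by (simp add: norm_mult mult_left_le)
    show "Re (of_real t * u) < 1/2"
    proof (cases "Re u \<le> 0")
      case True
      then have "t * Re u \<le> 0" using that by (simp add: mult_nonneg_nonpos)
      then show ?thesis by simp
    next
      case False
      then have "t * Re u \<le> 1 * Re u" using that by (intro mult_right_mono) auto
      then show ?thesis using Cons.prems by simp
    qed
  qed
  have f0: "f 0 = 0" by (simp add: f_def G_def word_Li_0 landen_sum_0)
  have "f 1 = 0"
  proof (cases "u = 0")
    case True
    then show ?thesis using f0 by (simp add: f_def)
  next
    case False
    show ?thesis
    \<comment> \<open>The endpoints are exceptional: at 0 the form \<open>dt/t\<close> is singular,
      and at 1 the point may lie on the circle. Continuity suffices there.\<close>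
    proof (rule has_derivative_zero_unique_strong_convex[of "{0..1}" "{0, 1}" f 0])
      show "continuous_on {0..1} f"
        unfolding f_def
      proof (rule continuous_on_compose2[OF cont])
        show "(\<lambda>t. of_real t * u) ` {0..1} \<subseteq> {x. norm x \<le> 1 \<and> Re x < 1/2}"
          using seg by (fastforce intro: order_trans)
      qed (intro continuous_intros)
      fix t :: real assume t: "t \<in> {0..1} - {0, 1}"
      have "(G has_field_derivative 0) (at (of_real t * u))"
        using seg[of t] t False by (intro deriv) auto
      moreover have "((\<lambda>t. of_real t * u) has_vector_derivative u) (at t)"
        by (auto intro!: derivative_eq_intros)
      ultimately have "((G \<circ> (\<lambda>t. of_real t * u)) has_vector_derivative u * 0) (at t)"
        by (rule field_vector_diff_chain_at[rotated])
      then show "(f has_derivative (\<lambda>h. 0)) (at t within {0..1})"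
        by (auto simp: f_def[abs_def] o_def has_vector_derivative_def intro: has_derivative_at_withinI)
    qed (use f0 in auto)
  qed
  then show ?case by (simp add: f_def G_def s'_def)
qed

section \<open>From index lists to words\<close>

text \<open>This is the usual iterated-integral word of a multiple polylogarithm, with one block of
  forms per index.\<close>

definition index_word :: "nat list \<Rightarrow> bool list" where
  "index_word k = concat (map (\<lambda>a. replicate (a - 1) False @ [True]) k)"

lemma index_word_simps:
  "index_word [] = []"
  "index_word (a # k) = replicate (a - 1) False @ True # index_word k"
  by (simp_all add: index_word_def)

lemma last_index_word: "k \<noteq> [] \<Longrightarrow> index_word k \<noteq> [] \<and> last (index_word k)"
proof (induction k)
  case (Cons a k)
  then show ?case by (cases "k = []") (auto simp: index_word_simps)
qed simp

lemma length_index_word: "\<forall>a\<in>set k. 0 < a \<Longrightarrow> length (index_word k) = sum_list k"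
  by (induction k) (auto simp: index_word_simps)

text \<open>Reading a word from its end, \<open>True\<close> opens a new index 1 and
  \<open>False\<close> raises the first index by 1. This turns the words of the Landen expansion
  back into index lists.\<close>

lemma index_word_surj:
  "w \<noteq> [] \<longrightarrow> last w \<Longrightarrow> \<exists>k. (\<forall>a\<in>set k. 0 < a) \<and> index_word k = w"
proof (induction w)
  case Nil
  show ?case by (intro exI[of _ "[]"]) (simp add: index_word_simps)
next
  case (Cons b w)
  then obtain k where k: "\<forall>a\<in>set k. 0 < a" "index_word k = w" by (auto split: if_splits)
  show ?case
  proof (cases b)
    case True
    then show ?thesis using k by (intro exI[of _ "1 # k"]) (simp add: index_word_simps)
  next
    case False
    then have "w \<noteq> []" using Cons.prems by auto
    then obtain a k' where k': "k = a # k'" using k by (cases k) (auto simp: index_word_simps)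
    then obtain m where "a = Suc m" using k by (cases a) auto
    then show ?thesis using k k' False by (intro exI[of _ "Suc a # k'"]) (auto simp: index_word_simps)
  qed
qed

section \<open>Nested sums over decreasing tuples\<close>

lemma decr_tuples_0: "decr_tuples 0 M = {[]}"
  by (auto simp: decr_tuples_def)

lemma decr_tuples_Suc: "decr_tuples (Suc r) M = (\<Union>m\<in>{1..M}. (#) m ` decr_tuples r (m - 1))"
proof (intro equalityI subsetI)
  fix n assume n: "n \<in> decr_tuples (Suc r) M"
  then obtain m n' where [simp]: "n = m # n'" by (cases n) (auto simp: decr_tuples_def)
  have "n' \<in> decr_tuples r (m - 1)" "m \<in> {1..M}" using n by (auto simp: decr_tuples_def)
  then show "n \<in> (\<Union>m\<in>{1..M}. (#) m ` decr_tuples r (m - 1))" by auto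
next
  fix n assume "n \<in> (\<Union>m\<in>{1..M}. (#) m ` decr_tuples r (m - 1))"
  then show "n \<in> decr_tuples (Suc r) M" by (fastforce simp: decr_tuples_def)
qed

lemma finite_decr_tuples: "finite (decr_tuples r M)"
  by (induction r arbitrary: M) (auto simp: decr_tuples_0 decr_tuples_Suc)

lemma sum_decr_tuples_Suc:
  "(\<Sum>n\<in>decr_tuples (Suc r) M. g n) = (\<Sum>m=1..M. \<Sum>n\<in>decr_tuples r (m - 1). g (m # n))"
proof -
  have "(\<Sum>n\<in>decr_tuples (Suc r) M. g n) = (\<Sum>m=1..M. \<Sum>n\<in>(#) m ` decr_tuples r (m - 1). g n)"
    unfolding decr_tuples_Suc by (rule sum.UNION_disjoint) (auto simp: finite_decr_tuples)
  also have "\<dots> = (\<Sum>m=1..M. \<Sum>n\<in>decr_tuples r (m - 1). g (m # n))"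
    by (simp add: sum.reindex)
  finally show ?thesis .
qed

definition harmonic_sum :: "nat list \<Rightarrow> nat \<Rightarrow> complex" where
  "harmonic_sum k M = (\<Sum>n\<in>decr_tuples (length k) M. 1 / (\<Prod>j<length k. of_nat (n ! j) ^ (k ! j)))"

text \<open>The largest entry is split off. The free weight \<open>g\<close> covers both the powers
  of \<open>x\<close> in \<open>Li\<close> and the constant 1 in
  \<open>harmonic_sum\<close>.\<close>

lemma sum_decr_tuples_Cons:
  "(\<Sum>n\<in>decr_tuples (length (a # k)) M.
      g (n ! 0) / (\<Prod>j<length (a # k). of_nat (n ! j) ^ ((a # k) ! j)))
    = (\<Sum>m=1..M. g m / of_nat m ^ a * harmonic_sum k (m - 1))"
  by (simp add: sum_decr_tuples_Suc harmonic_sum_def sum_distrib_left prod.lessThan_Suc_shift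
      del: prod.lessThan_Suc)

lemma word_coeff_replicate_False:
  "word_coeff (replicate r False @ w) n = word_coeff w n / real n ^ r"
  by (induction r) (auto simp: field_simps)

text \<open>The range up to \<open>n - 1\<close> encodes the strict inequality between the two
  largest entries. It includes 0 for the sake of an empty \<open>k\<close>, whose only nonzero
  coefficient sits there.\<close>

lemma word_coeff_index_word_Cons:
  assumes "0 < a" "0 < n"
  shows "word_coeff (index_word (a # k)) n = (\<Sum>m\<le>n - 1. word_coeff (index_word k) m) / real n ^ a"
proof -
  have "{..<n} = {..n - 1}" using assms by auto
  moreover have "real n * real n ^ (a - 1) = real n ^ a" using assms by (cases a) auto
  ultimately show ?thesis by (simp add: index_word_simps word_coeff_replicate_False)
qed

lemma sum_atMost_eq_Icc_1: "f 0 = 0 \<Longrightarrow> (\<Sum>m\<le>M. f m :: complex) = (\<Sum>m=1..M. f m)" for M :: nat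
  by (rule sum.mono_neutral_right) (auto simp: not_le)

lemma sum_word_coeff_index_word:
  "\<forall>a\<in>set k. 0 < a \<Longrightarrow> (\<Sum>m\<le>M. of_real (word_coeff (index_word k) m)) = harmonic_sum k M"
proof (induction k arbitrary: M)
  case Nil
  have "(\<Sum>m\<le>M. complex_of_real (word_coeff [] m)) = (\<Sum>m\<in>{0}. of_real (word_coeff [] m))"
    by (rule sum.mono_neutral_right) auto
  then show ?case by (simp add: index_word_simps harmonic_sum_def decr_tuples_0)
next
  case (Cons a k)
  have "(\<Sum>m\<le>M. of_real (word_coeff (index_word (a # k)) m))
      = (\<Sum>m=1..M. complex_of_real (word_coeff (index_word (a # k)) m))"
    by (rule sum_atMost_eq_Icc_1) (simp add: word_coeff_0 last_index_word)
  also have "\<dots> = (\<Sum>m=1..M. 1 / of_nat m ^ a * harmonic_sum k (m - 1))"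
    using Cons by (intro sum.cong) (auto simp: word_coeff_index_word_Cons simp flip: Cons.IH)
  also have "\<dots> = harmonic_sum (a # k) M"
    unfolding harmonic_sum_def[of "a # k"] by (rule sum_decr_tuples_Cons[symmetric])
  finally show ?case .
qed

text \<open>The nested sum truncated at \<open>M\<close> equals the partial sum of the power series
  for every \<open>M\<close>. Hence the limits agree on the circle too, where no absolute
  convergence is available.\<close>

lemma Li_eq_word_Li:
  assumes k: "k \<noteq> []" "\<forall>a\<in>set k. 0 < a" and x: "norm x \<le> 1" "x \<noteq> 1"
  shows "Li k x = word_Li (index_word k) x"
proof -
  obtain a k' where ak: "k = a # k'" using k by (cases k) auto
  have "(\<Sum>n\<in>decr_tuples (length k) M. x ^ (n ! 0) / (\<Prod>j<length k. of_nat (n ! j) ^ (k ! j)))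
      = (\<Sum>m\<le>M. of_real (word_coeff (index_word k) m) * x ^ m)" for M
  proof -
    have "(\<Sum>n\<in>decr_tuples (length k) M. x ^ (n ! 0) / (\<Prod>j<length k. of_nat (n ! j) ^ (k ! j)))
        = (\<Sum>m=1..M. x ^ m / of_nat m ^ a * harmonic_sum k' (m - 1))"
      unfolding ak by (rule sum_decr_tuples_Cons)
    also have "\<dots> = (\<Sum>m=1..M. of_real (word_coeff (index_word k) m) * x ^ m)"
      using k by (intro sum.cong)
        (auto simp: ak word_coeff_index_word_Cons simp flip: sum_word_coeff_index_word)
    also have "\<dots> = (\<Sum>m\<le>M. of_real (word_coeff (index_word k) m) * x ^ m)"
      by (rule sum_atMost_eq_Icc_1[symmetric]) (simp add: word_coeff_0 last_index_word k)
    finally show ?thesis .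
  qed
  then have "Li k x = lim (\<lambda>M. \<Sum>m\<le>M. of_real (word_coeff (index_word k) m) * x ^ m)"
    by (simp add: Li_def)
  also have "\<dots> = word_Li (index_word k) x"
    using word_Li_sums[OF x] by (intro limI) (simp add: sums_def_le)
  finally show ?thesis .
qed

lemma colored_MZV_eq_Li: "colored_MZV (a # k) (x # replicate (length k) 1) = Li (a # k) x"
  unfolding colored_MZV_def Li_def
  by (intro arg_cong[where f = lim] ext sum.cong refl)
    (simp add: prod.lessThan_Suc_shift prod_dividef del: prod.lessThan_Suc)

section \<open>Roots of unity\<close>

text \<open>With colors \<open>u, 1, ..., 1\<close> the condition on the first pair holds for every
  first index because \<open>u\<close> is not 1.\<close>

lemma word_Li_in_CMZV:
  assumes v: "v \<noteq> []" "last v" and u: "u ^ N = 1" "u \<noteq> 1" "0 < N"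
  shows "word_Li v u \<in> CMZV N (length v)"
proof -
  interpret Q: vector_space "\<lambda>(q::rat) (x::complex). of_rat q * x"
    by (rule vector_space_rat_complex)
  obtain k where k: "\<forall>a\<in>set k. 0 < a" "index_word k = v" using index_word_surj v by blast
  obtain a k' where ak: "k = a # k'" using k v by (cases k) (auto simp: index_word_simps)
  have "norm u = 1" using power_eq_1_iff[OF u(1)] u by auto
  then have "word_Li v u = colored_MZV k (u # replicate (length k') 1)"
    using Li_eq_word_Li[of k u] k u by (simp add: ak colored_MZV_eq_Li)
  moreover have "sum_list k = length v" using length_index_word k by auto
  ultimately show ?thesis
    unfolding CMZV_def using k u
    by (intro Q.span_base CollectI exI[of _ k] exI[of _ "u # replicate (length k') 1"])
      (auto simp: ak)
qed

lemma Li_landen_in_CMZV: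
  assumes k: "k \<noteq> []" "\<forall>a\<in>set k. 0 < a" and u: "u ^ N = 1" "0 < N" "Re u < 1/2"
  shows "Li k (u / (u - 1)) \<in> CMZV N (sum_list k)"
proof -
  interpret Q: vector_space "\<lambda>(q::rat) (x::complex). of_rat q * x"
    by (rule vector_space_rat_complex)
  define w where "w = index_word k"
  have w: "w \<noteq> []" "last w" "length w = sum_list k"
    using last_index_word length_index_word k by (auto simp: w_def)
  have nu: "norm u \<le> 1" using power_eq_1_iff[OF u(1)] u by auto
  have z: "norm (u / (u - 1)) < 1" using u by (intro norm_landen_less_1)
  have "word_Li v u \<in> CMZV N (sum_list k)" if "v \<in> set (landen w)" for v
  proof -
    have "length v = length w" "last v" using that w length_landen landen_last by auto
    moreover have "v \<noteq> []" using calculation(1) w(1) by auto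
    moreover have "u \<noteq> 1" using u by auto
    ultimately show ?thesis using word_Li_in_CMZV[of v u N] u w by auto
  qed
  \<comment> \<open>Arbitrary lists of words from the expansion make the claim suitable for list
    induction.\<close>
  then have "(\<Sum>v\<leftarrow>xs. word_Li v u) \<in> CMZV N (sum_list k)" if "set xs \<subseteq> set (landen w)" for xs
    using that
  proof (induction xs)
    case Nil
    show ?case unfolding CMZV_def by (simp add: Q.span_zero)
  next
    case (Cons v xs)
    then show ?case unfolding CMZV_def by (simp add: Q.span_add)
  qed
  then have "landen_sum w u \<in> CMZV N (sum_list k)" by (simp add: landen_sum_def)
  \<comment> \<open>The sign is written as a rational number so that it acts as a scalar on the
    span.\<close>
  then have "of_rat ((-1) ^ count_list w True) * landen_sum w u \<in> CMZV N (sum_list k)"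
    unfolding CMZV_def by (rule Q.span_scale)
  moreover have "Li k (u / (u - 1)) = word_Li w (u / (u - 1))"
    unfolding w_def using z by (intro Li_eq_word_Li k) auto
  moreover have "\<dots> = (-1) ^ count_list w True * landen_sum w u"
    using w nu u by (intro word_Li_landen) auto
  ultimately show ?thesis by (simp add: of_rat_power of_rat_minus)
qed

theorem theorem5p5:
  fixes r :: nat and k :: "nat list"
  assumes "1 \<le> r" and "length k = r" and "\<forall>a\<in>set k. 0 < a"
  shows "Li k ((1 + \<i>) / 2) \<in> CMZV 4 (sum_list k) \<and>
         Li k ((1 - \<i>) / 2) \<in> CMZV 4 (sum_list k)"
proof -
  have k: "k \<noteq> []" "\<forall>a\<in>set k. 0 < a" using assms by auto
  have "- \<i> / (- \<i> - 1) = (1 + \<i>) / 2" "\<i> / (\<i> - 1) = (1 - \<i>) / 2"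
    by (simp_all add: complex_eq_iff Re_divide Im_divide)
  moreover have "Li k (- \<i> / (- \<i> - 1)) \<in> CMZV 4 (sum_list k)"
    by (rule Li_landen_in_CMZV[OF k]) (simp_all add: power4_eq_xxxx)
  moreover have "Li k (\<i> / (\<i> - 1)) \<in> CMZV 4 (sum_list k)"
    by (rule Li_landen_in_CMZV[OF k]) (simp_all add: power4_eq_xxxx)
  ultimately show ?thesis by metis
qed

end
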